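(* Let $\rho>0$ and $\beta>0$. Then the radius of uniform convexity of $h_{\rho,\beta}$ is the smallest positive root $r$ of the equation $$1+2r\frac{h_{\rho,\beta}''(r)}{h_{\rho,\beta}'(r)}=0.$$
   Context: The Wright function is $\phi(\rho,\beta,z)=\sum_{n\geq0}\frac{z^n}{n!\,\Gamma(n\rho+\beta)}$ for $\rho>-1$, $z,\beta\in\mathbb{C}$. For $\rho>0,\beta>0$ define $h_{\rho,\beta}(z)=z\,\Gamma(\beta)\,\phi(\rho,\beta,-z)$. For an analytic function $f$ with $f(0)=0,f'(0)=1$, its radius of uniform convexity is $r^{uc}(f)=\sup\{r>0: f \text{ is analytic on } \mathbb{D}_r,\ f'\neq0 \text{ on } \mathbb{D}_r, \text{ and } \Re\big(1+\tfrac{zf''(z)}{f'(z)}\big)>\big|\tfrac{zf''(z)}{f'(z)}\big| \text{ for all } z\in\mathbb{D}_r\}$, where $\mathbb{D}_r=\{z\in\mathbb{C}:|z|<r\}$. *)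

theory Defs
  imports "HOL-Analysis.Analysis"
begin

definition wright :: "real \<Rightarrow> real \<Rightarrow> complex \<Rightarrow> complex" where
  "wright \<rho> \<beta> z = (\<Sum>n. z ^ n / (of_nat (fact n) * Gamma (complex_of_real (real n * \<rho> + \<beta>))))"

definition h_wright :: "real \<Rightarrow> real \<Rightarrow> complex \<Rightarrow> complex" where
  "h_wright \<rho> \<beta> z = z * Gamma (complex_of_real \<beta>) * wright \<rho> \<beta> (- z)"

definition radius_uc :: "(complex \<Rightarrow> complex) \<Rightarrow> real" where
  "radius_uc f = Sup {r. r > 0 \<and> f holomorphic_on ball 0 r \<and>
      (\<forall>z\<in>ball 0 r. deriv f z \<noteq> 0) \<and>
      (\<forall>z\<in>ball 0 r. Re (1 + z * deriv (deriv f) z / deriv f z)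
                       > cmod (z * deriv (deriv f) z / deriv f z))}"

end

theory Submission
  imports Defs "HOL-Complex_Analysis.Cauchy_Integral_Formula"
    "HOL-Computational_Algebra.Fundamental_Theorem_Algebra"
begin

text \<open>
  Let P be the derivative of h, and let G(z) = - z P'(z) / P(z). If the power series of G has
  nonnegative coefficients, then |G(z)| \<le> G(|z|), so the inequality defining uniform convexity holds
  on a disc as long as G < 1/2 on its radius, and fails at the first r with G(r) = 1/2, which is
  the equation 1 + 2 r h''(r) / h'(r) = 0.

  Nonnegativity holds for exp (- l z) times a polynomial with positive roots, and such functions are
  preserved by F \<mapsto> F + c z F' with c > 0. By Gauss's product for the Gamma function, P is a coefficientwise
  limit of functions obtained from exp (- l z) in this way, and the coefficients of G depend
  continuously on those of P.
\<close>

section \<open>Logarithmic derivatives and polynomials with positive roots\<close>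

text \<open>The minus sign makes a linear factor z - a with a > 0 contribute z / (a - z), whose
  coefficients are nonnegative.\<close>

definition neg_log_deriv :: "complex fps \<Rightarrow> complex fps" where
  "neg_log_deriv F = - (fps_X * fps_deriv F * inverse F)"

definition nonneg_coeffs :: "complex fps \<Rightarrow> bool" where
  "nonneg_coeffs F \<longleftrightarrow> (\<forall>n. fps_nth F n \<in> \<real>\<^sub>\<ge>\<^sub>0)"

definition positive_roots :: "complex poly \<Rightarrow> bool" where
  "positive_roots p \<longleftrightarrow> p \<noteq> 0 \<and> (\<forall>z. poly p z = 0 \<longrightarrow> Im z = 0 \<and> Re z > 0)"

text \<open>Over the complex numbers a nonconstant polynomial has a root; the linear factor there
  can be split off, and the cofactor inherits the condition on the roots.\<close>

lemma positive_roots_induct [consumes 1, case_names const root]: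
  assumes "positive_roots p"
    and const: "\<And>c. c \<noteq> 0 \<Longrightarrow> P [:c:]"
    and root: "\<And>a p. a > 0 \<Longrightarrow> positive_roots p \<Longrightarrow> P p \<Longrightarrow> P ([:- complex_of_real a, 1:] * p)"
  shows "P p"
  using assms(1)
proof (induction "degree p" arbitrary: p rule: less_induct)
  case less
  show ?case
  proof (cases "degree p = 0")
    case True
    then obtain c where "p = [:c:]" by (rule degree_eq_zeroE)
    with less.prems show ?thesis by (auto simp: positive_roots_def intro: const)
  next
    case False
    then obtain z where z: "poly p z = 0"
      using alg_closed_imp_poly_has_root by blast
    with less.prems have "Im z = 0" and pos: "Re z > 0"
      by (auto simp: positive_roots_def)
    then have z_eq: "z = of_real (Re z)"
      by (simp add: complex_eq_iff)
    from z obtain q where p: "p = [:- z, 1:] * q"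
      by (meson dvdE poly_eq_0_iff_dvd)
    with less.prems have q: "positive_roots q"
      by (auto simp: positive_roots_def)
    then have "degree p = Suc (degree q)"
      unfolding p by (subst degree_mult_eq) (auto simp: positive_roots_def)
    then have "P q" by (intro less.hyps q) simp
    then show ?thesis
      using root[OF pos q] z_eq p by simp
  qed
qed

text \<open>p'/p is a sum of terms 1 / (z - a) with a > 0, each of which has these signs.\<close>
lemma positive_roots_log_deriv_sign:
  assumes "positive_roots p" "\<not> (Im z = 0 \<and> Re z > 0)"
  shows "Im z * Im (poly (pderiv p) z / poly p z) \<le> 0"
    and "Im z = 0 \<Longrightarrow> Im (poly (pderiv p) z / poly p z) = 0 \<and> Re (poly (pderiv p) z / poly p z) \<le> 0"
proof -
  have "Im z * Im (poly (pderiv p) z / poly p z) \<le> 0 \<and>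
    (Im z = 0 \<longrightarrow> Im (poly (pderiv p) z / poly p z) = 0 \<and> Re (poly (pderiv p) z / poly p z) \<le> 0)"
    using assms(1)
  proof (induction rule: positive_roots_induct)
    case (const c)
    then show ?case by (simp add: pderiv_pCons)
  next
    case (root a p)
    have p0: "poly p z \<noteq> 0"
      using root assms(2) by (auto simp: positive_roots_def)
    have za: "z - of_real a \<noteq> 0"
      using root assms(2) by (auto simp: complex_eq_iff)
    define u v where "u = inverse (z - of_real a)" and "v = poly (pderiv p) z / poly p z"
    have *: "poly (pderiv ([:- complex_of_real a, 1:] * p)) z / poly ([:- complex_of_real a, 1:] * p) z
        = u + v"
      unfolding pderiv_mult u_def v_def using p0 za by (simp add: pderiv_pCons divide_simps) (simp add: algebra_simps)
    \<comment> \<open>Since a is real, z - a has the imaginary part of z, and taking the reciprocal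
      reverses its sign.\<close>
    have 1: "Im z * Im u \<le> 0"
      unfolding u_def by (simp add: divide_nonneg_nonneg)
    have 2: "Im u = 0 \<and> Re u \<le> 0" if "Im z = 0"
      unfolding u_def using that assms(2) root(1) by (auto simp: divide_nonpos_nonneg)
    show ?case
      using 1 2 root.IH unfolding * v_def[symmetric] by (auto simp: ring_distribs)
  qed
  then show "Im z * Im (poly (pderiv p) z / poly p z) \<le> 0"
    and "Im z = 0 \<Longrightarrow> Im (poly (pderiv p) z / poly p z) = 0 \<and> Re (poly (pderiv p) z / poly p z) \<le> 0"
    by auto
qed

text \<open>The operator is p \<mapsto> exp (l z) (1 + c z d/dz) (exp (- l z) p); at a new root off the positive
  half-line, p'/p = l - 1 / (c z) has the wrong sign.\<close>
lemma positive_roots_euler_operator: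
  assumes p: "positive_roots p" and c: "c > 0" and l: "l \<ge> 0"
  shows "positive_roots (p + smult (of_real c) (pCons 0 (pderiv p)) - smult (of_real (c * l)) (pCons 0 p))"
    (is "positive_roots ?q")
proof -
  have ev: "poly ?q z = poly p z + of_real c * z * poly (pderiv p) z - of_real (c * l) * z * poly p z" for z
    by (simp add: mult.assoc)
  have "poly ?q 0 \<noteq> 0"
    using p by (auto simp: ev positive_roots_def)
  then have nz: "?q \<noteq> 0" by (metis poly_0)
  have "Im z = 0 \<and> Re z > 0" if z: "poly ?q z = 0" for z
  proof (rule ccontr)
    assume neg: "\<not> (Im z = 0 \<and> Re z > 0)"
    have p0: "poly p z \<noteq> 0"
      using p neg by (auto simp: positive_roots_def)
    define w where "w = poly (pderiv p) z / poly p z"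
    have z0: "z \<noteq> 0"
      using z p0 by (auto simp: ev)
    have "poly p z * (1 + of_real c * z * w - of_real (c * l) * z) = 0"
      using z p0 by (simp add: ev w_def field_simps)
    then have "1 + of_real c * z * w - of_real (c * l) * z = 0"
      using p0 by simp
    then have "of_real c * z * w = of_real c * z * of_real l - 1"
      by (simp add: algebra_simps)
    also have "\<dots> = of_real c * z * (of_real l - inverse (of_real c * z))"
      using c z0 by (simp add: right_diff_distrib del: inverse_mult_distrib)
    finally have "of_real c * z * w = of_real c * z * (of_real l - inverse (of_real c * z))" .
    then have w: "w = of_real l - inverse (of_real c * z)"
      using c z0 by simp
    note sgn = positive_roots_log_deriv_sign[OF p neg, folded w_def]
    show False
    \<comment> \<open>On the negative real axis w = l - 1 / (c z) is positive; off the real axis l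
      drops out and Im w has the sign of Im z. Both contradict \<open>sgn\<close>.\<close>
    proof (cases "Im z = 0")
      case True
      with neg z0 have neg_re: "Re z < 0" by (auto simp: complex_eq_iff)
      have "z = of_real (Re z)"
        using True by (simp add: complex_eq_iff)
      then have "of_real c * z = of_real (c * Re z)"
        by (metis of_real_mult)
      then have "inverse (of_real c * z) = of_real (inverse (c * Re z))"
        by (simp only: of_real_inverse)
      then have "w = of_real (l - inverse (c * Re z))"
        using w by (simp only: of_real_diff)
      then have "Re w = l - inverse (c * Re z)"
        by (simp only: Re_complex_of_real)
      moreover have "inverse (c * Re z) < 0"
        using c neg_re by (simp add: mult_pos_neg)
      ultimately show False
        using sgn(2)[OF True] l by linarith
    next
      case False
      have "Im w = Im z * inverse (c * (Re z ^ 2 + Im z ^ 2))"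
      proof -
        have "w = of_real l - of_real (inverse c) * inverse z"
          using w by simp
        then show ?thesis
          by (simp del: of_real_inverse add: divide_inverse)
      qed
      then have "Im z * Im w = Im z ^ 2 * inverse (c * (Re z ^ 2 + Im z ^ 2))"
        by (simp add: power2_eq_square)
      moreover have "\<dots> > 0"
        using c False by (intro mult_pos_pos) (auto simp: sum_power2_gt_zero_iff)
      ultimately show False
        using sgn(1) by linarith
    qed
  qed
  with nz show ?thesis by (auto simp: positive_roots_def)
qed

section \<open>Exponentials times polynomials, and coefficientwise limits\<close>

lemma nonneg_coeffs_add: "nonneg_coeffs F \<Longrightarrow> nonneg_coeffs G \<Longrightarrow> nonneg_coeffs (F + G)"
  by (auto simp: nonneg_coeffs_def)

text \<open>The product rule divided by F G; nonzero constant terms make the formal inverses genuine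
  ones.\<close>

lemma neg_log_deriv_mult:
  assumes "fps_nth F 0 \<noteq> 0" "fps_nth G 0 \<noteq> 0"
  shows "neg_log_deriv (F * G) = neg_log_deriv F + neg_log_deriv G"
proof -
  have "F * inverse F = 1" "G * inverse G = 1"
    using assms by (auto intro: inverse_mult_eq_1')
  moreover have "neg_log_deriv (F * G) = 
     - (fps_X * fps_deriv F * inverse F * (G * inverse G)) - (fps_X * fps_deriv G * inverse G * (F * inverse F))"
    by (simp add: neg_log_deriv_def fps_inverse_mult algebra_simps)
  ultimately show ?thesis by (simp add: neg_log_deriv_def)
qed

text \<open>By additivity it suffices to look at one factor z - a, where the series is the sum of (z
  / a)^n over n \<ge> 1.\<close>

lemma positive_roots_nonneg_coeffs:
  assumes "positive_roots p"
  shows "nonneg_coeffs (neg_log_deriv (fps_of_poly p))"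
  using assms
proof (induction rule: positive_roots_induct)
  case (const c)
  then show ?case
    by (simp add: neg_log_deriv_def fps_of_poly_const nonneg_coeffs_def)
next
  case (root a p)
  define a' where "a' = complex_of_real a"
  have a': "a' \<noteq> 0" using root by (simp add: a'_def)
  \<comment> \<open>The geometric series of 1 / (a - z), hence minus the inverse of z - a.\<close>
  define S where "S = Abs_fps (\<lambda>n. inverse a' ^ Suc n)"
  have "fps_of_poly [:- a', 1:] * (- S) = 1"
  proof (rule fps_ext)
    fix n
    show "fps_nth (fps_of_poly [:- a', 1:] * (- S)) n = fps_nth 1 n"
      using a' by (cases n) (simp_all add: fps_of_poly_linear ring_distribs S_def)
  qed
  then have inv: "inverse (fps_of_poly [:- a', 1:]) = - S"
    by (metis fps_inverse_unique)
  have nl: "neg_log_deriv (fps_of_poly [:- a', 1:]) = fps_X * S"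
    unfolding neg_log_deriv_def inv by (simp add: fps_of_poly_linear)
  have "nonneg_coeffs (neg_log_deriv (fps_of_poly [:- a', 1:]))"
    using root(1) unfolding nl nonneg_coeffs_def 
    by (auto simp: S_def a'_def simp flip: of_real_inverse of_real_power of_real_mult)
  moreover have "poly p 0 \<noteq> 0"
    using root by (auto simp: positive_roots_def)
  ultimately show ?case
    using root.IH a' unfolding fps_of_poly_mult a'_def[symmetric]
    by (subst neg_log_deriv_mult) (auto intro!: nonneg_coeffs_add simp: poly_0_coeff_0)
qed

lemma neg_log_deriv_exp:
  "neg_log_deriv (fps_exp (- complex_of_real l)) = fps_const (of_real l) * fps_X"
proof -
  have "fps_exp (- complex_of_real l) * inverse (fps_exp (- complex_of_real l)) = 1"
    by (rule inverse_mult_eq_1') simp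
  then show ?thesis
    by (simp add: neg_log_deriv_def algebra_simps)
qed

text \<open>A class stable under F \<mapsto> F + c z F' with c > 0: the rate l stays fixed and only
  the polynomial factor changes.\<close>

definition positive_root_exp :: "real \<Rightarrow> complex fps \<Rightarrow> bool" where
  "positive_root_exp l F \<longleftrightarrow> (\<exists>p. positive_roots p \<and> F = fps_exp (- of_real l) * fps_of_poly p)"

text \<open>The exponential factor adds the single term l z to the contribution of the
  polynomial.\<close>

lemma positive_root_exp_nonneg_coeffs:
  assumes "positive_root_exp l F" "l \<ge> 0"
  shows "nonneg_coeffs (neg_log_deriv F)"
proof -
  obtain p where p: "positive_roots p" and F: "F = fps_exp (- of_real l) * fps_of_poly p"
    using assms by (auto simp: positive_root_exp_def)
  have "poly p 0 \<noteq> 0"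
    using p by (auto simp: positive_roots_def)
  then have "neg_log_deriv F = fps_const (of_real l) * fps_X + neg_log_deriv (fps_of_poly p)"
    unfolding F by (subst neg_log_deriv_mult) (auto simp: poly_0_coeff_0 neg_log_deriv_exp)
  moreover have "nonneg_coeffs (fps_const (of_real l) * fps_X)"
    using assms(2) by (auto simp: nonneg_coeffs_def fps_X_def)
  ultimately show ?thesis
    using positive_roots_nonneg_coeffs[OF p] by (simp add: nonneg_coeffs_add)
qed

text \<open>As F' = exp (- l z) (p' - l p), the exponential factors out and leaves the polynomial of
  \<open>positive_roots_euler_operator\<close>.\<close>

lemma positive_root_exp_euler:
  assumes "positive_root_exp l F" "l \<ge> 0" "c > 0"
  shows "positive_root_exp l (F + fps_const (of_real c) * fps_X * fps_deriv F)"
proof -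
  obtain p where p: "positive_roots p" and F: "F = fps_exp (- of_real l) * fps_of_poly p"
    using assms by (auto simp: positive_root_exp_def)
  define q where "q = p + smult (of_real c) (pCons 0 (pderiv p)) - smult (of_real (c * l)) (pCons 0 p)"
  have "positive_roots q"
    unfolding q_def by (rule positive_roots_euler_operator[OF p assms(3,2)])
  moreover have q: "fps_of_poly q = fps_of_poly p + fps_const (of_real c) * (fps_X * fps_deriv (fps_of_poly p))
      - fps_const (of_real (c * l)) * (fps_X * fps_of_poly p)"
    by (simp add: q_def fps_of_poly_add fps_of_poly_diff fps_of_poly_smult
        fps_of_poly_pCons fps_of_poly_pderiv)
  have "F + fps_const (of_real c) * fps_X * fps_deriv F = fps_exp (- of_real l) * fps_of_poly q"
    unfolding q by (simp add: F algebra_simps flip: fps_const_mult fps_const_neg)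
  ultimately show ?thesis
    by (auto simp: positive_root_exp_def)
qed

text \<open>Passing from F to F + c z F' multiplies the n-th coefficient by 1 + c n, so each factor
  of the product is one such step, starting from exp (- l z).\<close>

lemma positive_root_exp_prod:
  assumes "finite K" "\<And>k. k \<in> K \<Longrightarrow> c k > 0" "l \<ge> 0"
  shows "positive_root_exp l
    (Abs_fps (\<lambda>n. (\<Prod>k\<in>K. 1 + of_real (c k) * of_nat n) * (- of_real l) ^ n / fact n))"
  using assms(1,2)
proof (induction rule: finite_induct)
  case empty
  have "Abs_fps (\<lambda>n. (- of_real l) ^ n / fact n) = fps_exp (- complex_of_real l) * fps_of_poly [:1:]"
    by (simp add: fps_eq_iff)
  moreover have "positive_roots [:1:]"
    by (simp add: positive_roots_def)
  ultimately show ?case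
    by (auto simp: positive_root_exp_def)
next
  case (insert j K)
  define F where "F = Abs_fps (\<lambda>n. (\<Prod>k\<in>K. 1 + complex_of_real (c k) * of_nat n) * (- of_real l) ^ n / fact n)"
  have "positive_root_exp l (F + fps_const (of_real (c j)) * fps_X * fps_deriv F)"
    using insert assms(3) by (intro positive_root_exp_euler) (auto simp: F_def)
  also have "F + fps_const (of_real (c j)) * fps_X * fps_deriv F =
     Abs_fps (\<lambda>n. (\<Prod>k\<in>insert j K. 1 + of_real (c k) * of_nat n) * (- of_real l) ^ n / fact n)"
  proof (rule fps_ext)
    fix n
    have "fps_nth (F + fps_const (of_real (c j)) * fps_X * fps_deriv F) n
        = (1 + of_real (c j) * of_nat n) * fps_nth F n"
      by (cases n) (simp_all add: mult.assoc fps_deriv_nth ring_distribs)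
    then show "fps_nth (F + fps_const (of_real (c j)) * fps_X * fps_deriv F) n = fps_nth
     (Abs_fps (\<lambda>n. (\<Prod>k\<in>insert j K. 1 + of_real (c k) * of_nat n) * (- of_real l) ^ n / fact n)) n"
      using insert(1,2) by (simp add: F_def mult.assoc)
  qed
  finally show ?case .
qed

text \<open>With constant term 1, each coefficient of the logarithmic derivative is a polynomial in
  finitely many coefficients of the series. It therefore converges, and the nonnegative reals are
  closed.\<close>

lemma nonneg_coeffs_neg_log_deriv_limit:
  assumes lim: "\<And>n. (\<lambda>N. fps_nth (F N) n) \<longlonglongrightarrow> fps_nth P n"
    and F0: "\<And>N. fps_nth (F N) 0 = 1"
    and nonneg: "eventually (\<lambda>N. nonneg_coeffs (neg_log_deriv (F N))) sequentially"
  shows "nonneg_coeffs (neg_log_deriv P)"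
proof -
  have P0: "fps_nth P 0 = 1"
    using lim[of 0] by (simp add: F0 LIMSEQ_const_iff)
  \<comment> \<open>Obtained by comparing coefficients in
    \<open>neg_log_deriv H * H = - (fps_X * fps_deriv H)\<close>; the term i = n of the convolution
    has factor 1 and is isolated on the left.\<close>
  have rec: "fps_nth (neg_log_deriv H) n = - of_nat n * fps_nth H n - (\<Sum>i<n. fps_nth (neg_log_deriv H) i * fps_nth H (n - i))"
    if "fps_nth H 0 = 1" for H n
  proof -
    have "neg_log_deriv H * H = - (fps_X * fps_deriv H * (inverse H * H))"
      by (simp add: neg_log_deriv_def mult.assoc)
    also have "inverse H * H = 1"
      using that by (intro inverse_mult_eq_1) simp
    finally have "fps_nth (neg_log_deriv H * H) n = - of_nat n * fps_nth H n"
      by (cases n) (simp_all add: algebra_simps)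
    moreover have "fps_nth (neg_log_deriv H * H) n = (\<Sum>i<Suc n. fps_nth (neg_log_deriv H) i * fps_nth H (n - i))"
      by (simp add: fps_mult_nth atLeast0AtMost lessThan_Suc_atMost)
    ultimately show ?thesis
      using that by (simp add: algebra_simps)
  qed
  have conv: "(\<lambda>N. fps_nth (neg_log_deriv (F N)) n) \<longlonglongrightarrow> fps_nth (neg_log_deriv P) n" for n
  proof (induction n rule: less_induct)
    case (less n)
    show ?case
      unfolding rec[OF F0, of _ n] rec[OF P0, of n]
      by (intro tendsto_intros lim less) auto
  qed
  show ?thesis
    unfolding nonneg_coeffs_def
  proof
    fix n
    have "eventually (\<lambda>N. fps_nth (neg_log_deriv (F N)) n \<in> \<real>\<^sub>\<ge>\<^sub>0) sequentially"
      using nonneg by eventually_elim (simp add: nonneg_coeffs_def)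
    then show "fps_nth (neg_log_deriv P) n \<in> \<real>\<^sub>\<ge>\<^sub>0"
      by (intro Lim_in_closed_set[OF closed_nonneg_Reals_complex _ _ conv]) auto
  qed
qed

section \<open>Values of the logarithmic derivative and the nearest zero\<close>

text \<open>Without a constant term every power satisfies |z|^n \<le> (|z| / r) r^n. The factor |z|
  / r is kept because it yields strict inequalities inside the disc.\<close>

lemma nonneg_coeffs_eval_bound:
  assumes G: "nonneg_coeffs G" and G0: "fps_nth G 0 = 0"
    and r: "r > 0" "ereal r < fps_conv_radius G" and z: "norm z \<le> r"
  shows "norm (eval_fps G z) \<le> norm z / r * Re (eval_fps G (of_real r))"
proof -
  have Re_coeff: "Re (fps_nth G n) \<ge> 0" "norm (fps_nth G n) = Re (fps_nth G n)" for n
    using G by (auto simp: nonneg_coeffs_def complex_nonneg_Reals_iff cmod_eq_Re)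
  have "(\<lambda>n. fps_nth G n * of_real r ^ n) sums eval_fps G (of_real r)"
    using r by (intro sums_eval_fps) auto
  from sums_Re[OF this] have "(\<lambda>n. Re (fps_nth G n) * r ^ n) sums Re (eval_fps G (of_real r))"
    by (simp flip: of_real_power)
  then have sums: "(\<lambda>n. norm z / r * (Re (fps_nth G n) * r ^ n)) sums (norm z / r * Re (eval_fps G (of_real r)))"
    by (rule sums_mult)
  have le: "norm (fps_nth G n * z ^ n) \<le> norm z / r * (Re (fps_nth G n) * r ^ n)" for n
  proof (cases n)
    case (Suc m)
    have "norm z ^ n \<le> norm z / r * r ^ n"
      using z r(1) by (simp add: Suc mult_left_mono power_mono)
    then have "Re (fps_nth G n) * norm z ^ n \<le> Re (fps_nth G n) * (norm z / r * r ^ n)"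
      by (intro mult_left_mono Re_coeff)
    then show ?thesis
      by (simp add: norm_mult norm_power Re_coeff(2) mult_ac)
  qed (simp add: G0)
  have "norm (\<Sum>n. fps_nth G n * z ^ n) \<le> (\<Sum>n. norm z / r * (Re (fps_nth G n) * r ^ n))"
    by (rule norm_suminf_le[OF le sums_summable[OF sums]])
  then show ?thesis
    using sums by (simp add: eval_fps_def sums_iff)
qed

text \<open>All terms are real and nonnegative, so the linear one alone bounds the value from below;
  this gives growth when P has no zeros.\<close>

lemma nonneg_coeffs_eval_real:
  assumes G: "nonneg_coeffs G" and r: "r \<ge> 0" "ereal r < fps_conv_radius G"
  shows "Im (eval_fps G (of_real r)) = 0"
    and "Re (eval_fps G (of_real r)) \<ge> Re (fps_nth G 1) * r"
proof -
  have coeff: "Re (fps_nth G n) \<ge> 0" "Im (fps_nth G n) = 0" for n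
    using G by (auto simp: nonneg_coeffs_def complex_nonneg_Reals_iff cmod_eq_Re)
  have *: "(\<lambda>n. fps_nth G n * of_real r ^ n) sums eval_fps G (of_real r)"
    using r by (intro sums_eval_fps) auto
  from sums_Im[OF this] show "Im (eval_fps G (of_real r)) = 0"
    by (simp add: coeff(2) sums_iff flip: of_real_power)
  from sums_Re[OF *] have "(\<lambda>n. Re (fps_nth G n) * r ^ n) sums Re (eval_fps G (of_real r))"
    by (simp flip: of_real_power)
  moreover from this have "(\<Sum>n\<in>{1}. Re (fps_nth G n) * r ^ n) \<le> (\<Sum>n. Re (fps_nth G n) * r ^ n)"
    using r(1) coeff by (intro sum_le_suminf) (auto intro: sums_summable)
  ultimately show "Re (eval_fps G (of_real r)) \<ge> Re (fps_nth G 1) * r"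
    by (simp add: sums_iff)
qed

text \<open>The zero set is closed, so if it is nonempty it has a point of least modulus, which is
  not 0. The radius is extended real to cover the case without zeros.\<close>

lemma zero_free_radius:
  assumes P: "fps_conv_radius P = \<infinity>" and P0: "fps_nth P 0 \<noteq> (0 :: complex)"
  obtains R :: ereal where "R > 0" "\<And>z. ereal (norm z) < R \<Longrightarrow> eval_fps P z \<noteq> 0"
    "R = \<infinity> \<or> (\<exists>z. eval_fps P z = 0 \<and> R = ereal (norm z))"
proof (cases "\<exists>z. eval_fps P z = 0")
  case False
  then show ?thesis by (intro that[of \<infinity>]) auto
next
  case True
  have "continuous_on UNIV (eval_fps P)"
    using continuous_on_eval_fps[of P] by (simp add: P)
  then have "closed (eval_fps P -` {0})"
    by (intro closed_vimage) auto
  then obtain z0 where z0: "eval_fps P z0 = 0" "\<And>z. eval_fps P z = 0 \<Longrightarrow> dist 0 z0 \<le> dist 0 z"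
    using distance_attains_inf[of "eval_fps P -` {0}" 0] True by auto
  have "z0 \<noteq> 0"
    using z0(1) P0 by (auto simp: eval_fps_at_0)
  then show ?thesis
    using z0 by (intro that[of "ereal (norm z0)"]) force+
qed

text \<open>On a zero-free disc 1 / P is holomorphic, so the formal inverse converges there and
  formal identities become identities of functions.\<close>

lemma neg_log_deriv_eval:
  assumes P: "fps_conv_radius P = \<infinity>"
    and nz: "\<And>z. ereal (norm z) < R \<Longrightarrow> eval_fps P z \<noteq> 0"
  shows "fps_conv_radius (neg_log_deriv P) \<ge> R"
    and "\<And>z. ereal (norm z) < R \<Longrightarrow>
      eval_fps (neg_log_deriv P) z = - (z * eval_fps (fps_deriv P) z / eval_fps P z)"
proof -
  have P': "fps_conv_radius (fps_deriv P) = \<infinity>"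
    using fps_conv_radius_deriv[of P] by (simp add: P)
  have XP': "fps_conv_radius (fps_X * fps_deriv P) = \<infinity>"
    using fps_conv_radius_mult[of fps_X "fps_deriv P"] by (simp add: P')
  have inv: "fps_conv_radius (inverse P) \<ge> R"
    using fps_conv_radius_inverse[OF nz, of R] by (simp add: P)
  have prod: "fps_conv_radius (fps_X * fps_deriv P * inverse P) \<ge> R"
    using fps_conv_radius_mult[of "fps_X * fps_deriv P" "inverse P"] inv by (simp add: XP')
  then show "fps_conv_radius (neg_log_deriv P) \<ge> R"
    by (simp add: neg_log_deriv_def)
  fix z :: complex
  assume z: "ereal (norm z) < R"
  have z': "ereal (norm z) < fps_conv_radius (inverse P)"
    "ereal (norm z) < fps_conv_radius (fps_X * fps_deriv P * inverse P)"
    using z inv prod by (auto intro: less_le_trans)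
  have "eval_fps (inverse P) z = inverse (eval_fps P z)"
    using eval_fps_inverse[OF nz, of R z] z by (simp add: P)
  then show "eval_fps (neg_log_deriv P) z = - (z * eval_fps (fps_deriv P) z / eval_fps P z)"
    using z' by (simp add: neg_log_deriv_def eval_fps_minus eval_fps_mult XP' P' divide_inverse)
qed

text \<open>If the logarithmic derivative stayed below 1/2 up to the first zero z0, then
  t |P (t z0)|^2 would be nondecreasing in t on [1/2, 1], yet it vanishes at t = 1.\<close>
lemma zero_imp_log_deriv_large:
  fixes P :: "complex fps"
  assumes P: "fps_conv_radius P = \<infinity>" and z0: "eval_fps P z0 = 0" and "z0 \<noteq> 0"
    and nz: "\<And>z. norm z < norm z0 \<Longrightarrow> eval_fps P z \<noteq> 0"
  shows "\<exists>z. 0 < norm z \<and> norm z < norm z0 \<and>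
    norm (z * eval_fps (fps_deriv P) z / eval_fps P z) > 1 / 2"
proof (rule ccontr)
  assume "\<not> ?thesis"
  then have small: "norm (z * eval_fps (fps_deriv P) z / eval_fps P z) \<le> 1 / 2"
    if "0 < norm z" "norm z < norm z0" for z
    using that by force
  define p where "p t = eval_fps P (of_real t * z0)" for t :: real
  define p' where "p' t = z0 * eval_fps (fps_deriv P) (of_real t * z0)" for t :: real
  have dp: "(p has_vector_derivative p' t) (at t)" for t
  proof -
    have "(eval_fps P has_field_derivative eval_fps (fps_deriv P) (of_real t * z0)) (at (of_real t * z0))"
      by (rule has_field_derivative_eval_fps) (simp add: P)
    moreover have "((\<lambda>t. of_real t * z0) has_vector_derivative z0) (at t)"
      by (auto intro!: derivative_eq_intros simp: has_vector_derivative_def scaleR_conv_of_real)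
    ultimately have "(eval_fps P \<circ> (\<lambda>t. of_real t * z0) has_vector_derivative z0 * eval_fps (fps_deriv P) (of_real t * z0)) (at t)"
      by (intro field_vector_diff_chain_at) 
    then show ?thesis by (simp add: p_def[abs_def] p'_def o_def)
  qed
  define \<phi> where "\<phi> t = t * ((Re (p t))\<^sup>2 + (Im (p t))\<^sup>2)" for t
  define \<phi>' where "\<phi>' t = (Re (p t))\<^sup>2 + (Im (p t))\<^sup>2 + t * (2 * (Re (p t) * Re (p' t) + Im (p t) * Im (p' t)))" for t
  have d\<phi>: "(\<phi> has_real_derivative \<phi>' t) (at t)" for t
  proof -
    have "((\<lambda>t. Re (p t)) has_real_derivative Re (p' t)) (at t)"
         "((\<lambda>t. Im (p t)) has_real_derivative Im (p' t)) (at t)"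
      using dp[of t] by (auto simp: has_real_derivative_iff_has_vector_derivative
          intro: bounded_linear.has_vector_derivative bounded_linear_Re bounded_linear_Im)
    note [derivative_intros] = this
    show ?thesis
      unfolding \<phi>_def[abs_def] \<phi>'_def
      by (auto intro!: derivative_eq_intros simp: algebra_simps)
  qed
  have nonneg: "\<phi>' t \<ge> 0" if t: "1 / 2 \<le> t" "t \<le> 1" for t
  proof (cases "t = 1")
    case True
    then show ?thesis using z0 by (simp add: \<phi>'_def p_def)
  next
    case False
    have tz: "0 < norm (of_real t * z0)" "norm (of_real t * z0) < norm z0"
      using t False \<open>z0 \<noteq> 0\<close> by (auto simp: norm_mult)
    have pnz: "p t \<noteq> 0"
      unfolding p_def by (rule nz[OF tz(2)])
    have "norm (of_real t * p' t / p t) \<le> 1 / 2"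
      using small[OF tz] by (simp add: p_def p'_def mult.assoc)
    then have le: "t * norm (p' t) \<le> norm (p t) / 2"
      using pnz t by (simp add: norm_divide norm_mult divide_simps)
    \<comment> \<open>The right side is half the derivative of |p|^2. With \<open>le\<close> this
      gives \<phi>' \<ge> |p|^2 - 2 t |p| |p'| \<ge> 0.\<close>
    have cs: "- (norm (p t) * norm (p' t)) \<le> Re (p t) * Re (p' t) + Im (p t) * Im (p' t)"
      using Cauchy_Schwarz_ineq2[of "p t" "p' t"] by (simp add: inner_complex_def)
    have "norm (p t) * (t * norm (p' t)) \<le> norm (p t) * (norm (p t) / 2)"
      by (intro mult_left_mono le) auto
    moreover have "t * - (norm (p t) * norm (p' t)) \<le> t * (Re (p t) * Re (p' t) + Im (p t) * Im (p' t))"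
      using t by (intro mult_left_mono cs) auto
    moreover have "(Re (p t))\<^sup>2 + (Im (p t))\<^sup>2 = norm (p t) * norm (p t)"
      by (simp add: cmod_power2 flip: power2_eq_square)
    ultimately show ?thesis
      unfolding \<phi>'_def by (simp add: algebra_simps)
  qed
  have "\<phi> (1 / 2) \<le> \<phi> 1"
    by (rule DERIV_nonneg_imp_nondecreasing) (use d\<phi> nonneg in auto)
  moreover have "p (1 / 2) \<noteq> 0"
    unfolding p_def using \<open>z0 \<noteq> 0\<close> by (intro nz) (simp add: norm_mult)
  then have "\<phi> (1 / 2) > 0"
    by (auto simp: \<phi>_def complex_eq_iff sum_power2_gt_zero_iff)
  moreover have "\<phi> 1 = 0"
    using z0 by (simp add: \<phi>_def p_def)
  ultimately show False by simp
qed

text \<open>On the positive axis the series starts at 0 and is continuous up to the nearest zero of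
  P. It suffices to find a point before that zero with value at least 1/2 and to apply the
  intermediate value theorem.\<close>

lemma neg_log_deriv_attains_half:
  assumes P: "fps_conv_radius P = \<infinity>" and P0: "fps_nth P 0 = 1" and P1: "fps_nth P 1 \<noteq> 0"
    and G: "nonneg_coeffs (neg_log_deriv P)"
  obtains r where "r > 0" "ereal r < fps_conv_radius (neg_log_deriv P)"
    "eval_fps (neg_log_deriv P) (of_real r) = 1 / 2"
    "\<And>z. norm z \<le> r \<Longrightarrow> eval_fps P z \<noteq> 0"
    "\<And>z. norm z \<le> r \<Longrightarrow> 
      eval_fps (neg_log_deriv P) z = - (z * eval_fps (fps_deriv P) z / eval_fps P z)"
proof -
  let ?G = "neg_log_deriv P"
  obtain R where R: "R > 0" "\<And>z. ereal (norm z) < R \<Longrightarrow> eval_fps P z \<noteq> 0"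
    "R = \<infinity> \<or> (\<exists>z. eval_fps P z = 0 \<and> R = ereal (norm z))"
    by (rule zero_free_radius[OF P]) (use P0 in auto)
  have ev: "fps_conv_radius ?G \<ge> R" "\<And>z. ereal (norm z) < R \<Longrightarrow>
      eval_fps ?G z = - (z * eval_fps (fps_deriv P) z / eval_fps P z)"
    using neg_log_deriv_eval[OF P, of R] R(2) by blast+
  have G0: "fps_nth ?G 0 = 0"
    by (simp add: neg_log_deriv_def)
  have "fps_nth ?G 1 = - fps_nth P 1"
    by (simp add: neg_log_deriv_def P0 fps_mult_nth_1)
  moreover have "fps_nth ?G 1 \<in> \<real>\<^sub>\<ge>\<^sub>0"
    using G by (simp add: nonneg_coeffs_def)
  ultimately have G1: "Re (fps_nth ?G 1) > 0"
    using P1 by (auto elim!: nonneg_Reals_cases simp: complex_eq_iff)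
  have "\<exists>s>0. ereal s < R \<and> Re (eval_fps ?G (of_real s)) \<ge> 1 / 2"
    using R(3)
  proof
    assume "R = \<infinity>"
    \<comment> \<open>The point where the linear term alone equals 1/2.\<close>
    define s where "s = 1 / (2 * Re (fps_nth ?G 1))"
    have "s > 0" "Re (fps_nth ?G 1) * s = 1 / 2"
      using G1 by (auto simp: s_def)
    moreover have "ereal s < fps_conv_radius ?G"
      using ev(1) \<open>R = \<infinity>\<close> by simp
    ultimately show ?thesis
      using nonneg_coeffs_eval_real(2)[OF G, of s] \<open>R = \<infinity>\<close> by auto
  next
    assume "\<exists>z. eval_fps P z = 0 \<and> R = ereal (norm z)"
    then obtain z0 where z0: "eval_fps P z0 = 0" "R = ereal (norm z0)" by blast
    \<comment> \<open>The modulus exceeds 1/2 at some z, and by nonnegativity of the coefficients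
      the value at |z| on the positive axis is at least as large.\<close>
    obtain z where z: "0 < norm z" "norm z < norm z0"
      "norm (z * eval_fps (fps_deriv P) z / eval_fps P z) > 1 / 2"
      using zero_imp_log_deriv_large[OF P z0(1)] R(1,2) z0(2) by auto
    have "norm (eval_fps ?G z) > 1 / 2"
      using z ev(2)[of z] z0(2) by simp
    moreover have "ereal (norm z) < fps_conv_radius ?G"
      using z(2) z0(2) by (intro less_le_trans[OF _ ev(1)]) simp
    then have "norm (eval_fps ?G z) \<le> Re (eval_fps ?G (of_real (norm z)))"
      using nonneg_coeffs_eval_bound[OF G G0, of "norm z" z] z(1) by simp
    ultimately show ?thesis
      using z z0(2) by (intro exI[of _ "norm z"]) auto
  qed
  then obtain s where s: "s > 0" "ereal s < R" "Re (eval_fps ?G (of_real s)) \<ge> 1 / 2"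
    by blast
  have cont: "continuous_on {0..s} (\<lambda>r. Re (eval_fps ?G (of_real r)))"
  proof (rule continuous_on_Re, rule continuous_on_eval_fps')
    show "complex_of_real ` {0..s} \<subseteq> eball 0 (fps_conv_radius ?G)"
    proof safe
      fix r assume r: "r \<in> {0..s}"
      then have "ereal r \<le> ereal s" by simp
      also note s(2)
      also note ev(1)
      finally show "complex_of_real r \<in> eball 0 (fps_conv_radius ?G)"
        using r by simp
    qed
  qed (intro continuous_intros)
  have "\<exists>r\<ge>0. r \<le> s \<and> Re (eval_fps ?G (of_real r)) = 1 / 2"
    by (rule IVT'[OF _ s(3) _ cont]) (use s in \<open>auto simp: eval_fps_at_0 G0\<close>)
  then obtain r where r: "r \<ge> 0" "r \<le> s" "Re (eval_fps ?G (of_real r)) = 1 / 2"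
    by blast
  have "r \<noteq> 0"
    using r(3) by (auto simp: eval_fps_at_0 G0)
  with r(1) have r0: "r > 0" by simp
  have rR: "ereal r < R"
    using r(2) s(2) by (meson ereal_less_eq(3) le_less_trans)
  then have rG: "ereal r < fps_conv_radius ?G"
    using ev(1) by (rule less_le_trans)
  have "eval_fps ?G (of_real r) = 1 / 2"
    using r(3) nonneg_coeffs_eval_real(1)[OF G r(1) rG] by (simp add: complex_eq_iff)
  moreover have "ereal (norm z) < R" if "norm z \<le> r" for z :: complex
    using that rR by (meson ereal_less_eq(3) le_less_trans)
  ultimately show ?thesis
    using r0 rG R(2) ev(2) by (intro that[of r]) auto
qed

section \<open>Radius of uniform convexity from nonnegative coefficients\<close>

text \<open>With z f'' / f' = - G the equation reads G(r) = 1/2. Where |G| < 1/2 one has Re (1 - G)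
  \<ge> 1 - |G| > |G|, and no root of the equation lies there.\<close>

theorem radius_uc_of_nonneg_neg_log_deriv:
  assumes f: "f holomorphic_on UNIV" and df: "\<And>z. deriv f z = eval_fps P z"
    and P: "fps_conv_radius P = \<infinity>" and P0: "fps_nth P 0 = 1" and P1: "fps_nth P 1 \<noteq> 0"
    and G: "nonneg_coeffs (neg_log_deriv P)"
  shows "\<exists>r0>0.
     1 + 2 * complex_of_real r0 * deriv (deriv f) (complex_of_real r0) / deriv f (complex_of_real r0) = 0 \<and>
     (\<forall>r. 0 < r \<and> r < r0 \<longrightarrow>
        1 + 2 * complex_of_real r * deriv (deriv f) (complex_of_real r) / deriv f (complex_of_real r) \<noteq> 0) \<and>
     radius_uc f = r0"
proof -
  let ?G = "eval_fps (neg_log_deriv P)"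
  have G0: "fps_nth (neg_log_deriv P) 0 = 0"
    by (simp add: neg_log_deriv_def)
  obtain r0 where r0: "r0 > 0" "ereal r0 < fps_conv_radius (neg_log_deriv P)"
    "?G (of_real r0) = 1 / 2"
    "\<And>z. norm z \<le> r0 \<Longrightarrow> eval_fps P z \<noteq> 0"
    "\<And>z. norm z \<le> r0 \<Longrightarrow> ?G z = - (z * eval_fps (fps_deriv P) z / eval_fps P z)"
    using neg_log_deriv_attains_half[OF P P0 P1 G] by blast
  have "deriv f = eval_fps P"
    using df by auto
  then have ddf: "deriv (deriv f) z = eval_fps (fps_deriv P) z" for z
    by (simp add: eval_fps_deriv P)
  have ratio: "z * deriv (deriv f) z / deriv f z = - ?G z" if "norm z \<le> r0" for z
    using r0(5)[OF that] by (simp add: df ddf)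
  have eq: "1 + 2 * of_real r * deriv (deriv f) (of_real r) / deriv f (of_real r) = 1 - 2 * ?G (of_real r)"
    if "0 < r" "r \<le> r0" for r
  proof -
    have "2 * of_real r * deriv (deriv f) (of_real r) / deriv f (of_real r)
        = 2 * (of_real r * deriv (deriv f) (of_real r) / deriv f (of_real r))"
      by simp
    also have "\<dots> = 2 * - ?G (of_real r)"
      using that by (subst ratio) auto
    finally show ?thesis by simp
  qed
  have small: "norm (?G z) < 1 / 2" if "norm z < r0" for z
  proof -
    have "norm (?G z) \<le> norm z / r0 * Re (?G (of_real r0))"
      using that by (intro nonneg_coeffs_eval_bound[OF G G0 r0(1,2)]) auto
    also have "\<dots> < 1 / 2"
      using that r0(1) by (simp add: r0(3))
    finally show ?thesis .
  qed
  define S where "S = {r. r > 0 \<and> f holomorphic_on ball 0 r \<and>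
      (\<forall>z\<in>ball 0 r. deriv f z \<noteq> 0) \<and>
      (\<forall>z\<in>ball 0 r. Re (1 + z * deriv (deriv f) z / deriv f z)
                       > cmod (z * deriv (deriv f) z / deriv f z))}"
  have "r0 \<in> S"
  proof -
    have "Re (1 + z * deriv (deriv f) z / deriv f z) > cmod (z * deriv (deriv f) z / deriv f z)"
      if "z \<in> ball 0 r0" for z
    proof -
      have "norm z < r0" using that by simp
      then show ?thesis
        using small[of z] complex_Re_le_cmod[of "?G z"] by (simp add: ratio)
    qed
    moreover have "f holomorphic_on ball 0 r0"
      using f by (rule holomorphic_on_subset) simp
    ultimately show ?thesis
      using r0(1,4) by (auto simp: S_def df)
  qed
  \<comment> \<open>A larger disc contains r0 itself, where both sides of the strict inequality
    equal 1/2.\<close>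
  moreover have "r \<le> r0" if "r \<in> S" for r
  proof (rule ccontr)
    assume "\<not> r \<le> r0"
    then have "of_real r0 \<in> ball (0 :: complex) r"
      using r0(1) by simp
    with that have "Re (1 + of_real r0 * deriv (deriv f) (of_real r0) / deriv f (of_real r0))
        > cmod (of_real r0 * deriv (deriv f) (of_real r0) / deriv f (of_real r0))"
      unfolding S_def by blast
    then show False
      using r0(1) by (simp add: ratio r0(3))
  qed
  ultimately have "Sup S = r0"
    by (intro cSup_eq_maximum)
  then have "radius_uc f = r0"
    by (simp add: radius_uc_def S_def)
  moreover have "1 + 2 * of_real r * deriv (deriv f) (of_real r) / deriv f (of_real r) \<noteq> 0"
    if "0 < r" "r < r0" for r
  proof
    assume "1 + 2 * complex_of_real r * deriv (deriv f) (of_real r) / deriv f (of_real r) = 0"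
    then have "?G (of_real r) = 1 / 2"
      using eq[of r] that by (simp add: field_simps)
    then have "norm (?G (of_real r)) = norm (1 / 2 :: complex)"
      by (rule arg_cong)
    then show False
      using small[of "of_real r"] that by simp
  qed
  ultimately show ?thesis
    using r0(1) eq[of r0] by (intro exI[of _ r0]) (simp add: r0(3))
qed

section \<open>The power series of the normalized Wright function\<close>

text \<open>Gamma increases from 2 on, so only finitely many arguments need separate care.\<close>

lemma inverse_Gamma_bounded:
  assumes "\<rho> > 0" "\<beta> > 0"
  obtains B where "B > 0" "\<And>n. 1 / Gamma (real n * \<rho> + \<beta>) \<le> B"
proof -
  have pos: "real n * \<rho> + \<beta> > 0" for n
    using assms by (simp add: add_nonneg_pos)
  obtain N :: nat where N: "real N * \<rho> \<ge> 2"
    using assms(1) by (meson reals_Archimedean3 less_imp_le)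
  \<comment> \<open>The point 2 stands for all n \<ge> N; the sum of 1 / Gamma over A serves as the
    bound.\<close>
  define A where "A = insert 2 ((\<lambda>n. real n * \<rho> + \<beta>) ` {..<N})"
  have A: "finite A" "A \<noteq> {}" "\<And>x. x \<in> A \<Longrightarrow> x > 0"
    using pos by (auto simp: A_def)
  have "\<exists>x\<in>A. Gamma x \<le> Gamma (real n * \<rho> + \<beta>)" for n
  proof (cases "n < N")
    case True
    then show ?thesis by (auto simp: A_def)
  next
    case False
    then have "real n * \<rho> \<ge> real N * \<rho>"
      using assms by (intro mult_right_mono) auto
    then have "Gamma 2 < Gamma (real n * \<rho> + \<beta>)"
      using N assms by (intro Gamma_real_strict_mono) linarith+
    then show ?thesis by (auto simp: A_def)
  qed
  then have "1 / Gamma (real n * \<rho> + \<beta>) \<le> (\<Sum>x\<in>A. 1 / Gamma x)" for n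
  proof -
    obtain x where x: "x \<in> A" "Gamma x \<le> Gamma (real n * \<rho> + \<beta>)"
      using \<open>\<And>n. \<exists>x\<in>A. Gamma x \<le> Gamma (real n * \<rho> + \<beta>)\<close> by blast
    then have "1 / Gamma (real n * \<rho> + \<beta>) \<le> 1 / Gamma x"
      using A(3) pos Gamma_real_pos by (intro divide_left_mono mult_pos_pos) auto
    also have "\<dots> \<le> (\<Sum>x\<in>A. 1 / Gamma x)"
      using x(1) A Gamma_real_pos by (intro member_le_sum) (auto intro: less_imp_le)
    finally show ?thesis .
  qed
  moreover have "(\<Sum>x\<in>A. 1 / Gamma x) > 0"
    using A Gamma_real_pos by (intro sum_pos) auto
  ultimately show ?thesis using that by blast
qed

text \<open>The factor Gamma \<beta> sits inside each coefficient and the quotient is real, matching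
  the limit of real Gauss products.\<close>

definition h_wright_fps :: "real \<Rightarrow> real \<Rightarrow> complex fps" where
  "h_wright_fps \<rho> \<beta> = fps_X * Abs_fps (\<lambda>n.
     of_real (Gamma \<beta> / Gamma (real n * \<rho> + \<beta>)) * (- 1) ^ n / fact n)"

text \<open>Since 1 / Gamma is bounded along the arguments, a multiple of the exponential series
  dominates.\<close>

lemma h_wright_fps_conv_radius:
  assumes "\<rho> > 0" "\<beta> > 0"
  shows "fps_conv_radius (h_wright_fps \<rho> \<beta>) = \<infinity>"
proof -
  obtain B where B: "B > 0" "\<And>n. 1 / Gamma (real n * \<rho> + \<beta>) \<le> B"
    using inverse_Gamma_bounded[OF assms] by blast
  define F where "F = Abs_fps (\<lambda>n. complex_of_real (Gamma \<beta> / Gamma (real n * \<rho> + \<beta>)) * (- 1) ^ n / fact n)"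
  have "summable (\<lambda>n. fps_nth F n * z ^ n)" for z
  proof (rule summable_comparison_test')
    show "summable (\<lambda>n. Gamma \<beta> * B * (norm z ^ n /\<^sub>R fact n))"
      by (intro summable_mult summable_exp_generic)
    fix n
    have pos: "Gamma \<beta> > 0" "Gamma (real n * \<rho> + \<beta>) > 0"
      using assms by (auto intro!: Gamma_real_pos simp: add_nonneg_pos)
    have "norm (fps_nth F n * z ^ n) = Gamma \<beta> * (1 / Gamma (real n * \<rho> + \<beta>)) * (norm z ^ n / fact n)"
      using pos by (simp add: F_def norm_mult norm_divide norm_power)
    also have "\<dots> \<le> Gamma \<beta> * B * (norm z ^ n / fact n)"
      using pos B by (intro mult_right_mono mult_left_mono) auto
    finally show "norm (fps_nth F n * z ^ n) \<le> Gamma \<beta> * B * (norm z ^ n /\<^sub>R fact n)"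
      by (simp add: divide_inverse mult_ac)
  qed
  then have "fps_conv_radius F = \<infinity>"
    unfolding fps_conv_radius_def by (intro conv_radius_inftyI'')
  then show ?thesis
    using fps_conv_radius_mult[of fps_X F] by (simp add: h_wright_fps_def F_def)
qed

lemma h_wright_eq_eval_fps:
  assumes "\<rho> > 0" "\<beta> > 0"
  shows "h_wright \<rho> \<beta> z = eval_fps (h_wright_fps \<rho> \<beta>) z"
proof -
  define c where "c n = (- z) ^ n / (of_nat (fact n) * Gamma (complex_of_real (real n * \<rho> + \<beta>)))" for n
  have coeff: "fps_nth (h_wright_fps \<rho> \<beta>) (Suc n) * z ^ Suc n = z * Gamma (complex_of_real \<beta>) * c n" for n
    by (simp add: h_wright_fps_def c_def Gamma_complex_of_real power_minus[of z] mult_ac del: of_real_add)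
  have "(\<lambda>n. fps_nth (h_wright_fps \<rho> \<beta>) n * z ^ n) sums eval_fps (h_wright_fps \<rho> \<beta>) z"
    by (rule sums_eval_fps) (simp add: h_wright_fps_conv_radius[OF assms])
  then have "(\<lambda>n. fps_nth (h_wright_fps \<rho> \<beta>) (Suc n) * z ^ Suc n) sums eval_fps (h_wright_fps \<rho> \<beta>) z"
    by (subst sums_Suc_iff) (simp add: h_wright_fps_def)
  then have *: "(\<lambda>n. z * Gamma (complex_of_real \<beta>) * c n) sums eval_fps (h_wright_fps \<rho> \<beta>) z"
    by (simp only: coeff)
  show ?thesis
  \<comment> \<open>Summability of c is recovered by cancelling the factor z Gamma \<beta>, which
    must be nonzero.\<close>
  proof (cases "z = 0")
    case True
    then show ?thesis by (simp add: h_wright_def eval_fps_at_0 h_wright_fps_def)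
  next
    case False
    then have nz: "z * Gamma (complex_of_real \<beta>) \<noteq> 0"
      using Gamma_real_pos[OF assms(2)] by (simp add: Gamma_complex_of_real)
    then have "summable c"
      using sums_summable[OF *] by simp
    then have "z * Gamma (complex_of_real \<beta>) * suminf c = eval_fps (h_wright_fps \<rho> \<beta>) z"
      using * by (simp add: sums_iff suminf_mult)
    then show ?thesis
      by (simp only: h_wright_def wright_def c_def[abs_def])
  qed
qed

text \<open>Gauss's product for the Gamma function exhibits the derivative of h as a coefficientwise limit
  of (D + 1) times the product over k up to N of (rho D / (beta + k) + 1), applied to
  exp (- N powr (- rho) z), where D is z d/dz.\<close>
lemma h_wright_fps_deriv_nonneg_coeffs:
  assumes "\<rho> > 0" "\<beta> > 0"
  shows "nonneg_coeffs (neg_log_deriv (fps_deriv (h_wright_fps \<rho> \<beta>)))"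
proof -
  \<comment> \<open>This is N powr (- \<rho>) for N > 0; the exponential form is positive for every
    N, 0 included.\<close>
  define lam where "lam N = exp (- \<rho> * ln (real N))" for N
  \<comment> \<open>Index 0 carries the factor 1 + n of D + 1, and index j + 1 the factor 1 + \<rho>
    n / (\<beta> + j) of the Gauss product.\<close>
  define K where "K N = insert 0 (Suc ` {0..N})" for N
  define c where "c k = (case k of 0 \<Rightarrow> 1 | Suc j \<Rightarrow> \<rho> / (\<beta> + real j))" for k
  define F where "F N = Abs_fps (\<lambda>n. (\<Prod>k\<in>K N. 1 + complex_of_real (c k) * of_nat n) * (- of_real (lam N)) ^ n / fact n)" for N
  have "c k > 0" for k
    using assms by (auto simp: c_def split: nat.splits)
  then have "positive_root_exp (lam N) (F N)" for N
    unfolding F_def by (intro positive_root_exp_prod) (auto simp: K_def lam_def)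
  then have nonneg: "nonneg_coeffs (neg_log_deriv (F N))" for N
    by (rule positive_root_exp_nonneg_coeffs) (simp add: lam_def)
  have pos: "real n * \<rho> + \<beta> > 0" for n
    using assms by (simp add: add_nonneg_pos)
  have F_nth: "fps_nth (F N) n = of_real (of_nat (Suc n) * (- 1) ^ n / fact n *
      (Gamma_series \<beta> N / Gamma_series (real n * \<rho> + \<beta>) N))" for N n
  proof -
    have "(\<Prod>j=0..N. 1 + c (Suc j) * real n) = (\<Prod>j=0..N. (real n * \<rho> + \<beta> + real j) / (\<beta> + real j))"
      using assms by (intro prod.cong) (auto simp: c_def field_simps add_pos_nonneg[THEN less_imp_neq, symmetric])
    also have "\<dots> = pochhammer (real n * \<rho> + \<beta>) (Suc N) / pochhammer \<beta> (Suc N)"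
      by (simp add: pochhammer_Suc_prod prod_dividef)
    finally have prod: "(\<Prod>j=0..N. 1 + c (Suc j) * real n) = 
      pochhammer (real n * \<rho> + \<beta>) (Suc N) / pochhammer \<beta> (Suc N)" .
    have "lam N ^ n = exp (- (real n * \<rho> * ln (real N)))"
      by (simp add: lam_def mult.assoc flip: exp_of_nat_mult)
    \<comment> \<open>The quotient of the powers of N in the two Gauss products; their factorials
      cancel.\<close>
    then have "lam N ^ n = exp (\<beta> * ln (real N)) / exp ((real n * \<rho> + \<beta>) * ln (real N))"
      by (simp add: algebra_simps flip: exp_diff)
    then have "Gamma_series \<beta> N / Gamma_series (real n * \<rho> + \<beta>) N
       = (\<Prod>j=0..N. 1 + c (Suc j) * real n) * lam N ^ n"
      by (simp add: Gamma_series_def prod)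
    moreover have "(\<Prod>k\<in>K N. 1 + c k * real n) = (1 + real n) * (\<Prod>j=0..N. 1 + c (Suc j) * real n)"
      unfolding K_def by (subst prod.insert) (auto simp: prod.reindex c_def simp del: image_Suc_atLeastAtMost)
    moreover have "fps_nth (F N) n = of_real ((\<Prod>k\<in>K N. 1 + c k * real n) * (- lam N) ^ n / fact n)"
      by (simp add: F_def)
    ultimately show ?thesis
      by (simp add: power_minus[of "lam N"] mult_ac del: of_real_mult of_real_divide)
  qed
  have lim: "(\<lambda>N. fps_nth (F N) n) \<longlonglongrightarrow> fps_nth (fps_deriv (h_wright_fps \<rho> \<beta>)) n" for n
  proof -
    have "(\<lambda>N. Gamma_series \<beta> N / Gamma_series (real n * \<rho> + \<beta>) N) \<longlonglongrightarrow> Gamma \<beta> / Gamma (real n * \<rho> + \<beta>)"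
      using Gamma_real_pos[OF pos, of n] by (intro tendsto_divide Gamma_series_LIMSEQ) simp
    then have "(\<lambda>N. fps_nth (F N) n) \<longlonglongrightarrow>
       of_real (of_nat (Suc n) * (- 1) ^ n / fact n * (Gamma \<beta> / Gamma (real n * \<rho> + \<beta>)))"
      unfolding F_nth by (intro tendsto_of_real tendsto_mult_left)
    also have "of_real (of_nat (Suc n) * (- 1) ^ n / fact n * (Gamma \<beta> / Gamma (real n * \<rho> + \<beta>)))
        = fps_nth (fps_deriv (h_wright_fps \<rho> \<beta>)) n"
      by (simp add: h_wright_fps_def) (simp add: algebra_simps add_divide_distrib)
    finally show ?thesis .
  qed
  moreover have "fps_nth (F N) 0 = 1" for N
    by (simp add: F_def)
  ultimately show ?thesis
    using nonneg by (intro nonneg_coeffs_neg_log_deriv_limit) auto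
qed

theorem theorem3:
  fixes \<rho> \<beta> :: real
  assumes "\<rho> > 0" and "\<beta> > 0"
  shows "\<exists>r0>0.
     1 + 2 * complex_of_real r0 * deriv (deriv (h_wright \<rho> \<beta>)) (complex_of_real r0)
           / deriv (h_wright \<rho> \<beta>) (complex_of_real r0) = 0 \<and>
     (\<forall>r. 0 < r \<and> r < r0 \<longrightarrow>
        1 + 2 * complex_of_real r * deriv (deriv (h_wright \<rho> \<beta>)) (complex_of_real r)
           / deriv (h_wright \<rho> \<beta>) (complex_of_real r) \<noteq> 0) \<and>
     radius_uc (h_wright \<rho> \<beta>) = r0"
proof (rule radius_uc_of_nonneg_neg_log_deriv)
  let ?H = "h_wright_fps \<rho> \<beta>"
  have H: "h_wright \<rho> \<beta> = eval_fps ?H"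
    using h_wright_eq_eval_fps[OF assms] by auto
  have conv: "fps_conv_radius ?H = \<infinity>"
    by (rule h_wright_fps_conv_radius[OF assms])
  show "h_wright \<rho> \<beta> holomorphic_on UNIV"
    unfolding H by (intro holomorphic_intros) (simp add: conv)
  show "deriv (h_wright \<rho> \<beta>) z = eval_fps (fps_deriv ?H) z" for z
    by (simp add: H eval_fps_deriv conv)
  show "fps_conv_radius (fps_deriv ?H) = \<infinity>"
    using fps_conv_radius_deriv[of ?H] by (simp add: conv)
  have pos: "Gamma \<beta> > 0" "Gamma (\<rho> + \<beta>) > 0"
    using assms by (auto intro: Gamma_real_pos)
  \<comment> \<open>The second coefficient is - 2 Gamma \<beta> / Gamma (\<rho> + \<beta>).\<close>
  then show "fps_nth (fps_deriv ?H) 0 = 1" "fps_nth (fps_deriv ?H) 1 \<noteq> 0"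
    by (simp_all add: h_wright_fps_def)
  show "nonneg_coeffs (neg_log_deriv (fps_deriv ?H))"
    by (rule h_wright_fps_deriv_nonneg_coeffs[OF assms])
qed

end
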